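(* Let $\Lambda$ be an AR language satisfying $(Rabc)$. Let $\lambda_2$ be the stage of the first rule $(c)$, $\lambda_a$ the stage of the last rule $(a)$ before $\lambda_2$, $\lambda_b$ the stage of the last rule $(b)$ before $\lambda_2$, $\mu_a$ the stage of the first rule $(a)$ after $\lambda_2$, $\mu_b$ the stage of the first rule $(b)$ after $\lambda_2$. Let $x$ and $y$ be the elements of $\{a,b\}$ such that $\mu_x<\mu_y$, and let $X$ denote $A$ if $x=a$ and $B$ if $x=b$. Then no word of $\Lambda$ of length at least $$|w_{\lambda_y}|+\max\left(|C_{\mu_y+1}|,|X_{\mu_y+1}|\right)+1$$ can cluster for any permutation and any order on $\{a,b,c\}$. The bound is sharp for the Tribonacci language (the AR language with directive word $(abc)^\omega$): it contains a clustering word whose length is the bound minus $1$. The bound is not sharp in general, both in the case $\lambda_x<\lambda_y$ and in the case $\lambda_y<\lambda_x$: in each of these two cases there exist AR languages satisfying $(Rabc)$ for which no word of length equal to the bound minus $1$ clusters for any permutation and any order.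
   Context: AR (Arnoux-Rauzy) languages. The alphabet is $\{a,b,c\}$. Given an infinite sequence of rules $(x_k)_{k\ge0}$, $x_k\in\{a,b,c\}$, in which each of $a,b,c$ occurs infinitely often, define words by $A_0=a$, $B_0=b$, $C_0=c$ and: by rule $(a)$ at stage $k$ (i.e. $x_k=a$), $A_{k+1}=A_k$, $B_{k+1}=B_kA_k$, $C_{k+1}=C_kA_k$; by rule $(b)$, $A_{k+1}=A_kB_k$, $B_{k+1}=B_k$, $C_{k+1}=C_kB_k$; by rule $(c)$, $A_{k+1}=A_kC_k$, $B_{k+1}=B_kC_k$, $C_{k+1}=C_k$. The AR language $\Lambda$ is the set of all factors of the words $A_k,B_k,C_k$, $k\ge0$; its directive word is $x_0x_1x_2\cdots$. The words $w_k$ (the successive bispecial words of $\Lambda$) are given by: $w_0$ is the empty word, and $w_{k+1}=w_kA_k$, $w_kB_k$ or $w_kC_k$ according to whether the rule at stage $k$ is $(a)$, $(b)$ or $(c)$. $(Rabc)$: the rule at stage $0$ is $(a)$ and the first rule different from $(a)$ is $(b)$. Clustering. For a total order on the alphabet, written $a_1<\dots<a_r$, the Burrows-Wheeler transform $B(w)$ of a word $w=w_1\cdots w_n$ is obtained by listing its $n$ cyclic conjugates $w_i\cdots w_nw_1\cdots w_{i-1}$ (with multiplicity) in nondecreasing lexicographical order and reading the sequence of their last letters. The word $w$ clusters for this order and a permutation $\pi\neq \mathrm{Id}$ of the alphabet if $B(w)=(\pi a_1)^{n_{\pi a_1}}\cdots(\pi a_r)^{n_{\pi a_r}}$, where $n_a\ge0$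 is the number of occurrences of $a$ in $w$. *)

theory Defs
  imports "HOL-Library.List_Lexorder" "HOL-Library.Sublist"
begin

subsection \<open>Burrows-Wheeler transform and clustering\<close>

text \<open>A total order \<open>a\<^sub>1 < \<dots> < a\<^sub>r\<close> on the alphabet (the universe of the type) is given by
  its increasing enumeration \<open>[a\<^sub>1, \<dots>, a\<^sub>r]\<close>.\<close>

definition alphabet_order :: "'a list \<Rightarrow> bool" where
  "alphabet_order os \<longleftrightarrow> distinct os \<and> set os = UNIV"

definition rank :: "'a list \<Rightarrow> 'a \<Rightarrow> nat" where
  "rank os l = length (takeWhile (\<lambda>l'. l' \<noteq> l) os)"

definition conjugates :: "'a list \<Rightarrow> 'a list list" where
  "conjugates w = map (\<lambda>i. rotate i w) [0..<length w]"

text \<open>The key is a list of natural numbers, and such lists are ordered lexicographically.\<close>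

definition bwt :: "'a list \<Rightarrow> 'a list \<Rightarrow> 'a list" where
  "bwt os w = map last (sort_key (map (rank os)) (conjugates w))"

definition clusters_for :: "'a list \<Rightarrow> ('a \<Rightarrow> 'a) \<Rightarrow> 'a list \<Rightarrow> bool" where
  "clusters_for os \<pi> w \<longleftrightarrow>
     bwt os w = concat (map (\<lambda>l. replicate (count_list w (\<pi> l)) (\<pi> l)) os)"

definition clustering :: "'a list \<Rightarrow> bool" where
  "clustering w \<longleftrightarrow>
     (\<exists>os \<pi>. alphabet_order os \<and> bij \<pi> \<and> \<pi> \<noteq> id \<and> clusters_for os \<pi> w)"


subsection \<open>Arnoux-Rauzy languages\<close>

datatype letter = La | Lb | Lc

definition AR_directive :: "(nat \<Rightarrow> letter) \<Rightarrow> bool" where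
  "AR_directive d \<longleftrightarrow> (\<forall>l. infinite {k. d k = l})"

text \<open>\<open>AR_word d k La\<close>, \<open>AR_word d k Lb\<close>, \<open>AR_word d k Lc\<close> are the words
  \<open>A\<^sub>k\<close>, \<open>B\<^sub>k\<close>, \<open>C\<^sub>k\<close>.\<close>

primrec AR_word :: "(nat \<Rightarrow> letter) \<Rightarrow> nat \<Rightarrow> letter \<Rightarrow> letter list" where
  "AR_word d 0 l = [l]"
| "AR_word d (Suc k) l =
     (if l = d k then AR_word d k l else AR_word d k l @ AR_word d k (d k))"

definition AR_language :: "(nat \<Rightarrow> letter) \<Rightarrow> letter list set" where
  "AR_language d = {v. \<exists>k l. sublist v (AR_word d k l)}"

primrec bispecial :: "(nat \<Rightarrow> letter) \<Rightarrow> nat \<Rightarrow> letter list" where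
  "bispecial d 0 = []"
| "bispecial d (Suc k) = bispecial d k @ AR_word d k (d k)"

definition Rabc :: "(nat \<Rightarrow> letter) \<Rightarrow> bool" where
  "Rabc d \<longleftrightarrow> d 0 = La \<and> d (LEAST k. d k \<noteq> La) = Lb"

definition lambda2 :: "(nat \<Rightarrow> letter) \<Rightarrow> nat" where
  "lambda2 d = (LEAST k. d k = Lc)"

definition lam :: "(nat \<Rightarrow> letter) \<Rightarrow> letter \<Rightarrow> nat" where
  "lam d l = (GREATEST k. k < lambda2 d \<and> d k = l)"

definition mu :: "(nat \<Rightarrow> letter) \<Rightarrow> letter \<Rightarrow> nat" where
  "mu d l = (LEAST k. lambda2 d < k \<and> d k = l)"

text \<open>The letters \<open>x\<close> and \<open>y\<close> with \<open>{x, y} = {a, b}\<close> and \<open>\<mu>\<^sub>x < \<mu>\<^sub>y\<close>.\<close>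

definition letter_x :: "(nat \<Rightarrow> letter) \<Rightarrow> letter" where
  "letter_x d = (if mu d La < mu d Lb then La else Lb)"

definition letter_y :: "(nat \<Rightarrow> letter) \<Rightarrow> letter" where
  "letter_y d = (if mu d La < mu d Lb then Lb else La)"

definition bound :: "(nat \<Rightarrow> letter) \<Rightarrow> nat" where
  "bound d =
     length (bispecial d (lam d (letter_y d)))
     + max (length (AR_word d (mu d (letter_y d) + 1) Lc))
           (length (AR_word d (mu d (letter_y d) + 1) (letter_x d)))
     + 1"

definition tribonacci :: "nat \<Rightarrow> letter" where
  "tribonacci k = [La, Lb, Lc] ! (k mod 3)"

end

theory Submission
  imports Defs "HOL-Library.Infinite_Set"
begin

text \<open>If \<open>v\<close> clusters and \<open>x u y\<close>, \<open>x' u y'\<close> are two factors of the circular word \<open>v\<close> with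
  \<open>x \<noteq> x'\<close> and \<open>y \<noteq> y'\<close>, then the conjugates that begin with \<open>u y\<close> and \<open>u y'\<close> and end with
  \<open>x\<close> and \<open>x'\<close> show that \<open>x\<close> and \<open>x'\<close> are ordered by \<open>\<pi>\<^sup>-\<^sup>1\<close> as \<open>y\<close> and \<open>y'\<close> are ordered by the
  given order (\<open>clustering_imp_order_condition\<close>).

  In an AR language the word \<open>w\<^sub>k\<close> extends to \<open>l w\<^sub>k l'\<close> exactly when \<open>l\<close> or \<open>l'\<close> is the letter of
  rule \<open>k\<close>. A word that contains all these extensions of \<open>w\<^sub>k\<close> forces this letter to be the least
  for one of the two orders and the greatest for the other. Rules \<open>a\<close>, \<open>b\<close> and \<open>c\<close> together are
  therefore incompatible with clustering, since only two letters of three are extreme. Fewer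
  extensions suffice: those of the empty word, some of those at the first rule \<open>b\<close>, and, with
  \<open>p = \<lambda>\<^sub>2\<close>, both words \<open>c w\<^sub>p x\<close>, \<open>x w\<^sub>p c\<close> but only one of \<open>c w\<^sub>p y\<close>, \<open>y w\<^sub>p c\<close>
  (\<open>no_order_condition\<close>).

  The last of these is the rarest. It appears at the beginning of each block \<open>Y\<close> of stage \<open>\<mu>\<^sub>y\<close>, and
  two consecutive such blocks are at a distance at most the maximum \<open>M\<close> of the lengths of
  \<open>C\<close> and \<open>X\<close> at stage \<open>\<mu>\<^sub>y + 1\<close>. If a block begins at position \<open>P\<close>, then \<open>c w\<^sub>p y\<close> ends at \<open>P\<close>,
  while \<open>y w\<^sub>p c\<close> begins at \<open>P - |w\<^sub>q| - 1\<close> with \<open>q = \<lambda>\<^sub>y\<close>. A window that reaches from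
  \<open>P - |w\<^sub>q| - 1\<close> to \<open>P\<close> and is longer than \<open>|w\<^sub>p| + |Y\<^sub>p|\<close> contains one of the two, whence the length \<open>|w\<^sub>q| + M + 1\<close>.

  The same argument applied to the length \<open>|w\<^sub>q| + M\<close> leaves as possible clustering words only those
  that fill exactly the gap between two blocks, namely \<open>w\<^sub>q Y Z\<close> with \<open>Z\<close> one of the words \<open>C\<close>, \<open>X\<close>
  of stage \<open>\<mu>\<^sub>y\<close> (\<open>clustering_length_bound_minus_1\<close>). For the Tribonacci language this word clusters,
  and its transform is computed. For the directive words \<open>a(abc)\<^sup>\<omega>\<close> and \<open>(abcb)\<^sup>\<omega>\<close> it does not:
  read circularly, it has further factors across its ends, and these violate the order condition.\<close>

section \<open>The order condition for clustering words\<close>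

definition cyclic_factor :: "'a \<Rightarrow> 'a list \<Rightarrow> 'a \<Rightarrow> 'a list \<Rightarrow> bool" where
  "cyclic_factor x u y v \<longleftrightarrow> (\<exists>i t. rotate i v = u @ y # t @ [x])"

text \<open>Here \<open>g\<close> ranks the letters by the order of the alphabet and \<open>f\<close> by their position in the
  Burrows-Wheeler transform.\<close>

definition order_condition :: "('a \<Rightarrow> nat) \<Rightarrow> ('a \<Rightarrow> nat) \<Rightarrow> 'a list \<Rightarrow> bool" where
  "order_condition f g v \<longleftrightarrow>
     (\<forall>u x x' y y'. cyclic_factor x u y v \<longrightarrow> cyclic_factor x' u y' v \<longrightarrow> x \<noteq> x' \<longrightarrow>
        g y < g y' \<longrightarrow> f x < f x')"

text \<open>For the factors \<open>x u1 u2 y\<close> of the circular word that run over its end.\<close>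

lemma cyclic_factor_wrapI: "cyclic_factor x (u1 @ u2) y (u2 @ y # t @ x # u1)"
proof -
  have "rotate (length (u2 @ y # t @ [x])) ((u2 @ y # t @ [x]) @ u1) = u1 @ (u2 @ y # t @ [x])"
    by (rule rotate_append)
  then show ?thesis
    unfolding cyclic_factor_def
    by (intro exI[of _ "length (u2 @ y # t @ [x])"] exI[of _ t]) simp
qed

lemma sublist_imp_cyclic_factor:
  assumes "sublist (x # u @ [y]) v"
  shows "cyclic_factor x u y v"
proof -
  obtain s t where v: "v = s @ (x # u @ [y]) @ t"
    using assms by (auto simp: sublist_def)
  have "rotate (length (s @ [x])) ((s @ [x]) @ (u @ y # t)) = (u @ y # t) @ s @ [x]"
    by (rule rotate_append)
  then show ?thesis
    unfolding cyclic_factor_def v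
    by (intro exI[of _ "length (s @ [x])"] exI[of _ "t @ s"]) simp
qed

lemma nth_rank:
  assumes "l \<in> set os"
  shows "rank os l < length os" and "os ! rank os l = l"
proof -
  show "rank os l < length os"
    using assms unfolding rank_def by (induction os) auto
  then show "os ! rank os l = l"
    unfolding rank_def using nth_length_takeWhile by fastforce
qed

lemma rank_nth: "distinct os \<Longrightarrow> i < length os \<Longrightarrow> rank os (os ! i) = i"
  using nth_rank[of "os ! i" os] nth_eq_iff_index_eq[of os] nth_mem[of i os] by metis

lemma inj_rank: "alphabet_order os \<Longrightarrow> inj (rank os)"
  unfolding alphabet_order_def by (metis UNIV_I injI nth_rank)

lemma sorted_blocks:
  assumes "sorted (map h os)" and "\<And>l. f (p l) = h l"
  shows "sorted (map f (concat (map (\<lambda>l. replicate (n l) (p l)) os)))"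
  using assms(1)
proof (induction os)
  case (Cons a os)
  then show ?case by (auto simp: sorted_append assms(2))
qed simp

lemma map_less_map_if_branch:
  fixes g :: "'a \<Rightarrow> nat"
  shows "g y < g y' \<Longrightarrow> map g (u @ y # s) < map g (u @ y' # t)"
  by (simp add: list_less_def lexord_append_leftI)

text \<open>A conjugate beginning with \<open>u y\<close> precedes one beginning with \<open>u y'\<close> when \<open>y\<close> is below \<open>y'\<close>, so
  its last letter comes earlier in the transform. There the letters appear in blocks, in the order
  of their images under \<open>\<pi>\<^sup>-\<^sup>1\<close>.\<close>

theorem clustering_imp_order_condition:
  assumes "clustering v"
  obtains f g where "inj f" "inj g" "order_condition f g v"
proof -
  obtain os \<pi> where os: "alphabet_order os" and \<pi>: "bij \<pi>"
    and cl: "clusters_for os \<pi> v"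
    using assms unfolding clustering_def by blast
  define g where "g = rank os"
  define f where "f = rank os \<circ> inv \<pi>"
  have inj_g: "inj g" using os by (simp add: g_def inj_rank)
  have inj_f: "inj f"
    unfolding f_def using \<pi> os by (simp add: inj_compose inj_rank bij_is_inj bij_imp_bij_inv)
  define S where "S = sort_key (map g) (conjugates v)"
  have S: "sorted (map (map g) S)" by (simp add: S_def)
  have last_sorted: "sorted (map f (map last S))"
  proof -
    have "sorted (map (rank os) os)"
      using os by (simp add: alphabet_order_def sorted_iff_nth_mono rank_nth)
    moreover have "f (\<pi> l) = rank os l" for l
      using \<pi> by (simp add: f_def bij_is_inj)
    ultimately have "sorted (map f (concat (map (\<lambda>l. replicate (count_list v (\<pi> l)) (\<pi> l)) os)))"
      by (rule sorted_blocks)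
    then show ?thesis
      using cl by (simp add: clusters_for_def bwt_def S_def g_def)
  qed
  have conj: "z \<in> set S" if "rotate i v = z" "z \<noteq> []" for i z
  proof -
    have "v \<noteq> []" using that by auto
    then have "i mod length v < length v" by simp
    moreover have "z = rotate (i mod length v) v"
      using that(1) by (simp add: rotate_conv_mod[symmetric])
    ultimately show ?thesis
      by (auto simp: S_def conjugates_def)
  qed
  have "order_condition f g v"
    unfolding order_condition_def
  proof (intro allI impI)
    fix u x x' y y'
    assume "cyclic_factor x u y v" "cyclic_factor x' u y' v"
      and ne: "x \<noteq> x'" and less: "g y < g y'"
    then obtain i t i' t' where z: "rotate i v = u @ y # t @ [x]"
      and z': "rotate i' v = u @ y' # t' @ [x']"
      unfolding cyclic_factor_def by blast
    obtain k where k: "k < length S" "S ! k = u @ y # t @ [x]"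
      using conj[OF z] by (auto simp: in_set_conv_nth)
    obtain k' where k': "k' < length S" "S ! k' = u @ y' # t' @ [x']"
      using conj[OF z'] by (auto simp: in_set_conv_nth)
    have "map g (S ! k) < map g (S ! k')"
      unfolding k k' using less by (rule map_less_map_if_branch)
    then have "k < k'"
      using sorted_nth_mono[OF S, of k' k] k(1) k'(1) by (auto simp: not_less[symmetric])
    then have "f (last (S ! k)) \<le> f (last (S ! k'))"
      using sorted_nth_mono[OF last_sorted, of k k'] k' by simp
    then show "f x < f x'"
      using ne inj_f by (simp add: k(2) k'(2) le_less inj_eq)
  qed
  with inj_f inj_g show thesis by (rule that)
qed

text \<open>The extensions \<open>e\<close> of the empty word make \<open>a\<close> extreme, on opposite sides for the two orders;
  say it is the least letter for \<open>g\<close>. With the extensions \<open>b\<close>, the letter \<open>b\<close> is the greatest for \<open>g\<close>,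
  so that the orders are \<open>a < c < b\<close> for \<open>g\<close> and \<open>b < c < a\<close> for \<open>f\<close>. Now
  \<open>c w y\<close> and \<open>x w c\<close> compare \<open>c, x\<close> for \<open>f\<close> with \<open>y, c\<close> for \<open>g\<close>; as \<open>c\<close> lies between \<open>x\<close> and \<open>y\<close>, they
  are ordered in opposite ways. The words \<open>y w c\<close> and \<open>c w x\<close> are treated in the same way.\<close>

lemma no_order_condition:
  fixes v :: "letter list"
  assumes oc: "order_condition f g v" "inj f" "inj g"
    and xy: "x \<noteq> y" "x \<noteq> Lc" "y \<noteq> Lc"
    and e: "cyclic_factor La [] Lb v" "cyclic_factor Lb [] La v"
           "cyclic_factor La [] Lc v" "cyclic_factor Lc [] La v"
    and b: "cyclic_factor Lc u Lb v" "cyclic_factor Lb u Lc v"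
           "cyclic_factor La u Lb v \<or> cyclic_factor Lb u La v"
    and c: "cyclic_factor Lc w x v" "cyclic_factor x w Lc v"
           "cyclic_factor Lc w y v \<or> cyclic_factor y w Lc v"
  shows False
proof -
  have R: "g r < g r' \<longleftrightarrow> f l < f l'"
    if "cyclic_factor l z r v" "cyclic_factor l' z r' v" "l \<noteq> l'" "r \<noteq> r'" for l l' r r' z
    using oc that unfolding order_condition_def by (metis injD linorder_less_linear order_less_asym)
  have ne: "f La \<noteq> f Lb" "f La \<noteq> f Lc" "f Lb \<noteq> f Lc" "g La \<noteq> g Lb" "g La \<noteq> g Lc" "g Lb \<noteq> g Lc"
    using oc by (auto simp: inj_eq)
  note a1 = R[OF e(1) e(2)] R[OF e(3) e(4)] R[OF e(1) e(4)] R[OF e(3) e(2)]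
  note b1 = R[OF b(1) b(2)]
  have b2: "(g Lb < g Lc \<longleftrightarrow> f La < f Lb) \<or> (g Lb < g La \<longleftrightarrow> f Lc < f Lb)"
    using b(3) R[OF _ b(2), of La Lb] R[OF b(1), of Lb La] by auto
  note c1 = R[OF c(1) c(2)]
  have c2: "(g y < g Lc \<longleftrightarrow> f Lc < f x) \<or> (g Lc < g x \<longleftrightarrow> f y < f Lc)"
    using c(3) R[OF _ c(2), of Lc y] R[OF _ c(1), of y Lc] xy by auto
  have "x = La \<and> y = Lb \<or> x = Lb \<and> y = La"
    using xy by (metis letter.exhaust)
  then show False using a1 b1 b2 c1 c2 ne xy by auto
qed


section \<open>Bispecial words and blocks\<close>

abbreviation AR_concat :: "(nat \<Rightarrow> letter) \<Rightarrow> nat \<Rightarrow> letter list \<Rightarrow> letter list" where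
  "AR_concat d k u \<equiv> concat (map (AR_word d k) u)"

lemma AR_word_prefix_mono: "j \<le> k \<Longrightarrow> prefix (AR_word d j l) (AR_word d k l)"
  by (induction rule: dec_induct) auto

lemma bispecial_prefix_mono: "j \<le> k \<Longrightarrow> prefix (bispecial d j) (bispecial d k)"
  by (induction rule: dec_induct) simp_all

text \<open>This conjugation relation lets the occurrences of \<open>w\<^sub>k\<close> be read from both sides: the blocks
  that follow \<open>w\<^sub>k\<close> can be exchanged with their reversals that precede it.\<close>

lemma bispecial_AR_word: "bispecial d k @ AR_word d k l = rev (AR_word d k l) @ bispecial d k"
proof (induction k arbitrary: l)
  case (Suc k)
  have step: "bispecial d k @ AR_word d k l @ s = rev (AR_word d k l) @ bispecial d k @ s" for l s
    using Suc[of l] by (simp flip: append_assoc)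
  show ?case by (simp add: step)
qed simp

text \<open>Every block boundary of stage \<open>k\<close> is preceded by \<open>w\<^sub>k\<close>, provided that \<open>w\<^sub>k\<close> is placed in front of
  the first block.\<close>

lemma bispecial_suffix_AR_concat: "suffix (bispecial d k) (bispecial d k @ AR_concat d k u)"
proof -
  have "bispecial d k @ AR_concat d k u = concat (map (rev \<circ> AR_word d k) u) @ bispecial d k"
  proof (induction u)
    case (Cons l u)
    have "bispecial d k @ AR_concat d k (l # u) = rev (AR_word d k l) @ bispecial d k @ AR_concat d k u"
      using bispecial_AR_word[of d k l] by (simp flip: append_assoc)
    then show ?case using Cons by simp
  qed simp
  then show ?thesis by (simp add: suffix_def)
qed

lemma bispecial_suffix_mono: "j \<le> k \<Longrightarrow> suffix (bispecial d j) (bispecial d k)"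
proof (induction rule: dec_induct)
  case (step k)
  have "suffix (bispecial d k) (bispecial d (Suc k))"
    using bispecial_suffix_AR_concat[of d k "[d k]"] by simp
  then show ?case by (rule suffix_order.order_trans[OF step.IH])
qed simp

lemma AR_word_before_first_rule:
  assumes "\<And>j. j < k \<Longrightarrow> d j \<noteq> l"
  shows "AR_word d k l = l # bispecial d k"
  using assms
proof (induction k)
  case (Suc k)
  have "d k \<noteq> l" by (rule Suc.prems) simp
  moreover have "AR_word d k l = l # bispecial d k" by (rule Suc.IH, rule Suc.prems) simp
  ultimately show ?case by simp
qed simp

lemma bispecial_after_last_rule:
  assumes "d j = l" "j < k" "\<And>i. j < i \<Longrightarrow> i < k \<Longrightarrow> d i \<noteq> l"
  shows "bispecial d k = bispecial d j @ AR_word d k l"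
  using assms(2,3)
proof (induction k)
  case (Suc k)
  show ?case
  proof (cases "j = k")
    case False
    then have "j < k" using Suc.prems by simp
    moreover have "l \<noteq> d k" using Suc.prems(2)[of k] \<open>j < k\<close> by auto
    ultimately show ?thesis using Suc by simp
  qed (use assms(1) in simp)
qed simp

lemma hd_AR_word: "\<exists>s. AR_word d k l = l # s"
  by (induction k) auto

lemma AR_word_const:
  assumes "j \<le> k" "\<And>i. j \<le> i \<Longrightarrow> i < k \<Longrightarrow> d i = l"
  shows "AR_word d k l = AR_word d j l"
  using assms by (induction rule: dec_induct) simp_all

lemma length_AR_word_mono: "j \<le> k \<Longrightarrow> length (AR_word d j l) \<le> length (AR_word d k l)"
  by (simp add: AR_word_prefix_mono prefix_length_le)

text \<open>Since \<open>w\<^sub>k = w\<^sub>j L\<^sub>k\<close>, the conjugation relation gives \<open>w\<^sub>k L\<^sub>k = rev L\<^sub>k w\<^sub>j L\<^sub>k\<close>, and \<open>rev L\<^sub>k\<close>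
  ends with the letter \<open>l\<close>. This is where \<open>\<lambda>\<^sub>y\<close> enters the bound.\<close>

lemma last_rule_letter_before_bispecial:
  assumes "d j = l" "j < k" "\<And>i. j < i \<Longrightarrow> i < k \<Longrightarrow> d i \<noteq> l"
  shows "suffix (l # bispecial d j) (bispecial d k)"
proof -
  obtain s where s: "AR_word d k l = l # s" using hd_AR_word by blast
  have "rev (AR_word d k l) @ bispecial d j @ AR_word d k l = bispecial d k @ AR_word d k l"
    using bispecial_after_last_rule[of d j l k, OF assms] bispecial_AR_word[of d k l] by simp
  then have "bispecial d k = rev s @ l # bispecial d j" by (simp add: s)
  then show ?thesis by (simp add: suffix_def)
qed

lemma AR_concat_Suc: "\<exists>u'. AR_concat d (Suc k) u = AR_concat d k u'"
proof
  show "AR_concat d (Suc k) u = AR_concat d k (concat (map (\<lambda>l. if l = d k then [l] else [l, d k]) u))"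
    by (induction u) auto
qed

lemma AR_concat_lower: "k \<le> K \<Longrightarrow> \<exists>u'. AR_concat d K u = AR_concat d k u'"
proof (induction K arbitrary: u)
  case (Suc K)
  show ?case
  proof (cases "k = Suc K")
    case False
    obtain u' where "AR_concat d (Suc K) u = AR_concat d K u'" using AR_concat_Suc by blast
    moreover obtain u'' where "AR_concat d K u' = AR_concat d k u''"
      using Suc False by (meson le_SucE)
    ultimately show ?thesis by metis
  qed (auto simp del: AR_word.simps)
next
  case 0
  then show ?case by (intro exI[of _ u]) simp
qed

lemma AR_language_in_AR_concat:
  assumes "v \<in> AR_language d"
  shows "\<exists>u. sublist v (AR_concat d k u)"
proof -
  obtain j l where "sublist v (AR_word d j l)" using assms by (auto simp: AR_language_def)
  moreover have "sublist (AR_word d j l) (AR_word d (max j k) l)"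
    by (intro prefix_imp_sublist AR_word_prefix_mono) simp
  moreover obtain u where u: "AR_concat d (max j k) [l] = AR_concat d k u"
    using AR_concat_lower[of k "max j k" d "[l]"] by auto
  moreover have "AR_word d (max j k) l = AR_concat d k u" using u by simp
  ultimately show ?thesis by (metis sublist_order.order_trans)
qed

section \<open>Blocks in a window\<close>

lemma concat_crossing:
  assumes "N < length (concat (map h u))"
  shows "\<exists>u1 s u2. u = u1 @ s # u2 \<and> length (concat (map h u1)) \<le> N
           \<and> N < length (concat (map h u1)) + length (h s)"
  using assms
proof (induction u arbitrary: N)
  case (Cons a u)
  show ?case
  proof (cases "N < length (h a)")
    case True
    then show ?thesis by (intro exI[of _ "[]"]) auto
  next
    case False
    then have "N - length (h a) < length (concat (map h u))" using Cons.prems by simp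
    then obtain u1 s u2 where "u = u1 @ s # u2" "length (concat (map h u1)) \<le> N - length (h a)"
       "N - length (h a) < length (concat (map h u1)) + length (h s)"
      using Cons.IH by blast
    then show ?thesis using False by (intro exI[of _ "a # u1"]) auto
  qed
qed simp

text \<open>The factor \<open>v\<close> is placed at position \<open>i\<close> of a word \<open>P s Q\<close>, so that \<open>s\<close> is the gap between two
  consecutive beginnings of blocks \<open>Z\<close> of the letter \<open>d k\<close> at stage \<open>k\<close>, and the second of these is the
  first one after position \<open>i + N\<close>. Every other block of stage \<open>k\<close> is followed by \<open>Z\<close>, so \<open>s\<close> consists
  of \<open>Z\<close> and at most one more block.\<close>

lemma AR_window:
  assumes v: "v \<in> AR_language d" and N: "N < length v"
  obtains i P s Q where
    "length (bispecial d k) \<le> i" "i + length v \<le> length (P @ s @ Q)"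
    "v = take (length v) (drop i (P @ s @ Q))"
    "suffix (bispecial d k) P" "suffix (bispecial d k) (P @ s)" "prefix (AR_word d k (d k)) Q"
    "length P \<le> i + N" "i + N < length (P @ s)"
    "s = AR_word d k (d k) \<or> (\<exists>l. l \<noteq> d k \<and> s = AR_word d k (d k) @ AR_word d k l)"
proof -
  define z where "z = d k"
  define Z where "Z = AR_word d k z"
  \<comment> \<open>Moving the block \<open>Z\<close> that ends each word of stage \<open>k + 1\<close> to its front makes every \<open>h\<close>-block
      begin with \<open>Z\<close>.\<close>
  define h where "h l = (if l = z then Z else Z @ AR_word d k l)" for l
  let ?w = "bispecial d k"
  obtain u0 where u0: "sublist v (AR_concat d (Suc k) u0)"
    using AR_language_in_AR_concat[OF v] by blast
  \<comment> \<open>The additional letter ensures that a block \<open>Z\<close> begins after the end of \<open>v\<close>.\<close>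
  define u where "u = u0 @ [z]"
  have "AR_concat d (Suc k) u = AR_concat d (Suc k) u0 @ Z" by (simp add: u_def Z_def z_def)
  with u0 obtain q t where cat: "AR_concat d (Suc k) u = q @ v @ t @ Z"
    by (auto simp: sublist_def)
  have shift: "Z @ AR_concat d (Suc k) u = concat (map h u) @ Z" for u
    by (induction u) (auto simp: h_def Z_def z_def)
  have coded: "\<exists>u'. concat (map h u) = AR_concat d k u'" for u
  proof
    show "concat (map h u) = AR_concat d k (concat (map (\<lambda>l. if l = z then [z] else [z, l]) u))"
      by (induction u) (auto simp: h_def Z_def)
  qed
  have H: "concat (map h u) @ Z = Z @ q @ v @ t @ Z" using shift[of u] cat by simp
  then have H': "concat (map h u) = Z @ q @ v @ t" by simp
  define i where "i = length (?w @ Z @ q)"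
  have "length (Z @ q) + N < length (concat (map h u))" using N by (simp add: H')
  then obtain u1 s u2 where u: "u = u1 @ s # u2"
    and le: "length (concat (map h u1)) \<le> length (Z @ q) + N"
    and less: "length (Z @ q) + N < length (concat (map h u1)) + length (h s)"
    using concat_crossing[of "length (Z @ q) + N" h u] by blast
  define P where "P = ?w @ concat (map h u1)"
  define Q where "Q = concat (map h u2) @ Z"
  have W: "P @ h s @ Q = ?w @ Z @ q @ v @ t @ Z"
    using H by (simp add: P_def Q_def u)
  show thesis
  proof (rule that[of i P "h s" Q])
    show "length ?w \<le> i" by (simp add: i_def)
    show "i + length v \<le> length (P @ h s @ Q)" unfolding W by (simp add: i_def)
    show "v = take (length v) (drop i (P @ h s @ Q))" unfolding W by (simp add: i_def)
    show "suffix ?w P"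
      using coded[of u1] bispecial_suffix_AR_concat unfolding P_def by metis
    have "P @ h s = ?w @ concat (map h (u1 @ [s]))" by (simp add: P_def)
    then show "suffix ?w (P @ h s)"
      using coded[of "u1 @ [s]"] bispecial_suffix_AR_concat by metis
    show "prefix (AR_word d k (d k)) Q"
      unfolding Q_def by (cases u2) (auto simp: h_def Z_def z_def)
    show "length P \<le> i + N" using le by (simp add: P_def i_def)
    show "i + N < length (P @ h s)" using less by (simp add: P_def i_def)
    show "h s = AR_word d k (d k) \<or> (\<exists>l. l \<noteq> d k \<and> h s = AR_word d k (d k) @ AR_word d k l)"
      by (auto simp: h_def Z_def z_def)
  qed
qed

lemma sublist_window:
  assumes "suffix e1 R" "prefix e2 Q" "i + length e1 \<le> length R" "length R + length e2 \<le> i + n"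
  shows "sublist (e1 @ e2) (take n (drop i (R @ Q)))"
proof -
  obtain r q where r: "R = r @ e1" and q: "Q = e2 @ q"
    using assms(1,2) by (auto simp: suffix_def prefix_def)
  have "i \<le> length r" using assms(3) r by simp
  then have "take n (drop i (R @ Q)) = drop i r @ (e1 @ e2) @ take (n - (length r - i) - length e1 - length e2) q"
    using assms(4) by (simp add: r q)
  then show ?thesis unfolding sublist_def by blast
qed


lemma AR_word_first_c:
  assumes "\<And>j. j \<le> p \<Longrightarrow> d j = Lc \<longleftrightarrow> j = p"
  shows "d p = Lc" and "AR_word d p Lc = Lc # bispecial d p"
  using assms by (auto intro!: AR_word_before_first_rule)

section \<open>Extensions at the first rule \<open>c\<close>\<close>

text \<open>The stage \<open>p\<close> is that of the first rule \<open>c\<close>. Near a beginning of a block of \<open>l\<close> at a stage after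
  \<open>p\<close>, the word reads \<open>\<dots> c w\<^sub>p L\<^sub>p c \<dots>\<close> with the block beginning at \<open>L\<^sub>p\<close>. So \<open>c w\<^sub>p l\<close> ends with the
  first letter of the block.\<close>

lemma bispecial_left_extension:
  assumes p: "\<And>j. j \<le> p \<Longrightarrow> d j = Lc \<longleftrightarrow> j = p" and "p < k" "l \<noteq> Lc"
    and R: "suffix (bispecial d k) R" and Q: "prefix (AR_word d k l) Q"
    and i: "i + length (bispecial d p) + 1 \<le> length R" "length R + 1 \<le> i + n"
  shows "sublist (Lc # bispecial d p @ [l]) (take n (drop i (R @ Q)))"
proof -
  have "bispecial d (Suc p) = bispecial d p @ Lc # bispecial d p"
    using AR_word_first_c[of p d, OF p] by simp
  then have "suffix (Lc # bispecial d p) (bispecial d (Suc p))"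
    by (simp add: suffix_def)
  also have "suffix (bispecial d (Suc p)) (bispecial d k)"
    using \<open>p < k\<close> by (intro bispecial_suffix_mono) simp
  finally have "suffix (Lc # bispecial d p) (bispecial d k)" .
  then have "suffix (Lc # bispecial d p) R"
    using R by (rule suffix_order.order_trans)
  moreover have "prefix [l] Q"
    using Q hd_AR_word[of d k l] by (auto simp: prefix_def)
  ultimately have "sublist ((Lc # bispecial d p) @ [l]) (take n (drop i (R @ Q)))"
    using i by (intro sublist_window) auto
  then show ?thesis by simp
qed

text \<open>As \<open>w\<^sub>p = w\<^sub>q L\<^sub>p\<close>, the word \<open>l w\<^sub>p c\<close> also appears there, with \<open>l w\<^sub>q\<close> before the beginning of
  the block and \<open>L\<^sub>p c\<close> after it.\<close>

lemma bispecial_right_extension: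
  assumes p: "\<And>j. j \<le> p \<Longrightarrow> d j = Lc \<longleftrightarrow> j = p" and "p < k" "l \<noteq> Lc"
    and q: "d q = l" "q < p" "\<And>j. q < j \<Longrightarrow> j < p \<Longrightarrow> d j \<noteq> l"
    and R: "suffix (bispecial d k) R" and Q: "prefix (AR_word d k l) Q"
    and i: "i + length (bispecial d q) + 1 \<le> length R" "length R + length (AR_word d p l) + 1 \<le> i + n"
  shows "sublist (l # bispecial d p @ [Lc]) (take n (drop i (R @ Q)))"
proof -
  have "suffix (l # bispecial d q) (bispecial d k)"
    using last_rule_letter_before_bispecial[of d q l p] q bispecial_suffix_mono[of p k d] \<open>p < k\<close>
    by (meson less_imp_le suffix_order.order_trans)
  then have "suffix (l # bispecial d q) R"
    using R by (rule suffix_order.order_trans)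
  moreover have "prefix (AR_word d p l @ [Lc]) Q"
  proof -
    have "AR_word d (Suc p) l = (AR_word d p l @ [Lc]) @ bispecial d p"
      using AR_word_first_c[of p d, OF p] \<open>l \<noteq> Lc\<close> by simp
    then have "prefix (AR_word d p l @ [Lc]) (AR_word d (Suc p) l)"
      by (metis prefixI)
    also have "prefix (AR_word d (Suc p) l) (AR_word d k l)"
      using \<open>p < k\<close> by (intro AR_word_prefix_mono) simp
    also note Q
    finally show ?thesis .
  qed
  ultimately have "sublist ((l # bispecial d q) @ AR_word d p l @ [Lc]) (take n (drop i (R @ Q)))"
    using i by (intro sublist_window) auto
  moreover have "bispecial d p = bispecial d q @ AR_word d p l"
    using q by (rule bispecial_after_last_rule)
  ultimately show ?thesis by simp
qed

text \<open>The stages of the statement, for a directive word \<open>d\<close>: \<open>m\<close> is that of the first rule \<open>b\<close>, \<open>p\<close> is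
  \<open>\<lambda>\<^sub>2\<close>, and \<open>qx, qy, mx, my\<close> are \<open>\<lambda>\<^sub>x, \<lambda>\<^sub>y, \<mu>\<^sub>x, \<mu>\<^sub>y\<close>.\<close>

locale AR_stages =
  fixes d :: "nat \<Rightarrow> letter" and x y :: letter and m p qx qy mx my :: nat
  assumes xy: "x \<noteq> y" "x \<noteq> Lc" "y \<noteq> Lc"
    and m: "0 < m" "m < p" "d m = Lb" "\<And>j. j < m \<Longrightarrow> d j = La"
    and p: "\<And>j. j \<le> p \<Longrightarrow> d j = Lc \<longleftrightarrow> j = p"
    and qx: "d qx = x" "qx < p" "\<And>j. qx < j \<Longrightarrow> j < p \<Longrightarrow> d j \<noteq> x"
    and qy: "d qy = y" "qy < p" "\<And>j. qy < j \<Longrightarrow> j < p \<Longrightarrow> d j \<noteq> y"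
    and mx: "d mx = x" "p < mx" "\<And>j. p \<le> j \<Longrightarrow> j < mx \<Longrightarrow> d j = Lc"
    and my: "d my = y" "mx < my"
begin

abbreviation w :: "nat \<Rightarrow> letter list" where "w \<equiv> bispecial d"

definition M :: nat where
  "M = max (length (AR_word d (Suc my) Lc)) (length (AR_word d (Suc my) x))"

lemma letter_cases: "l = x \<or> l = y \<or> l = Lc"
  using xy by (metis letter.exhaust)

lemma word_c_p: "AR_word d p Lc = Lc # w p"
  using p by (rule AR_word_first_c)

text \<open>The fourth inequality says that \<open>M\<close> leaves room for \<open>c w\<^sub>p\<close>, a gap between two blocks \<open>X\<close> of stage
  \<open>\<mu>\<^sub>x\<close>, and a further block \<open>X\<close>.\<close>

lemma block_lengths:
  "length (AR_word d mx Lc) = Suc (length (w p))"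
  "length (AR_word d p x) \<le> length (AR_word d mx x)"
  "length (AR_word d p y) + Suc (length (w p)) \<le> length (AR_word d mx y)"
  "length (AR_word d mx x) + length (AR_word d mx y) + length (AR_word d mx x) + Suc (length (w p)) \<le> M"
  "length (AR_word d my y) < M"
proof -
  have "AR_word d mx Lc = AR_word d p Lc"
    using mx by (intro AR_word_const) auto
  then show c: "length (AR_word d mx Lc) = Suc (length (w p))"
    by (simp add: word_c_p)
  show "length (AR_word d p x) \<le> length (AR_word d mx x)"
    using mx by (intro length_AR_word_mono) simp
  have "length (AR_word d (Suc p) y) \<le> length (AR_word d mx y)"
    using mx by (intro length_AR_word_mono) simp
  then show "length (AR_word d p y) + Suc (length (w p)) \<le> length (AR_word d mx y)"
    using p[of p] xy by (simp add: word_c_p)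
  have "length (AR_word d (Suc mx) y) \<le> length (AR_word d my y)"
       "length (AR_word d (Suc mx) Lc) \<le> length (AR_word d my Lc)"
    using my by (auto intro!: length_AR_word_mono simp del: AR_word.simps)
  moreover have "length (AR_word d my Lc) + length (AR_word d my y) \<le> M"
    using my xy by (simp add: M_def)
  ultimately show "length (AR_word d mx x) + length (AR_word d mx y) + length (AR_word d mx x)
       + Suc (length (w p)) \<le> M"
    and "length (AR_word d my y) < M"
    using mx xy c by auto
qed

text \<open>The first block \<open>X\<close> of stage \<open>\<mu>\<^sub>x\<close> that begins late enough for \<open>c w\<^sub>p\<close> to fit before it is
  still early enough for both extensions to end within \<open>v\<close>.\<close>

lemma x_extensions:
  assumes v: "v \<in> AR_language d" and len: "length (w qy) + M \<le> length v"
  shows "sublist (Lc # w p @ [x]) v" and "sublist (x # w p @ [Lc]) v"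
proof -
  have "length (w p) < length v" using len block_lengths by simp
  from AR_window[OF v this, of mx] obtain i P s Q where
    W: "v = take (length v) (drop i ((P @ s) @ Q))" "suffix (w mx) (P @ s)" "prefix (AR_word d mx x) Q"
    and P: "length P \<le> i + length (w p)" and lo: "i + length (w p) < length (P @ s)"
    and s: "s = AR_word d mx x \<or> (\<exists>l. l \<noteq> x \<and> s = AR_word d mx x @ AR_word d mx l)"
    using mx(1) by (metis append.assoc)
  have "length s \<le> length (AR_word d mx x) + length (AR_word d mx y)"
    using s letter_cases block_lengths by fastforce
  with P have hi: "length (P @ s) + length (AR_word d p x) + 1 \<le> i + length v"
    using len block_lengths by simp
  have qx_le: "length (w qx) \<le> length (w p)"
    using qx by (intro prefix_length_le bispecial_prefix_mono) simp
  show "sublist (Lc # w p @ [x]) v"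
    using bispecial_left_extension[of p d mx x "P @ s" Q i "length v"] p mx xy W lo hi by simp
  show "sublist (x # w p @ [Lc]) v"
    using bispecial_right_extension[of p d mx x qx "P @ s" Q i "length v"] p mx xy qx qx_le W lo hi
    by simp
qed

text \<open>The first block \<open>Y\<close> of stage \<open>\<mu>\<^sub>y\<close> preceded in \<open>v\<close> by at least \<open>|w\<^sub>q| + 1\<close> letters begins in \<open>v\<close>, or
  else directly after \<open>v\<close> when the gap has the maximal length \<open>M\<close>. In the first case, if neither
  extension at this block were contained in \<open>v\<close>, the length of \<open>v\<close> would be at most the sum of the
  lengths of \<open>w\<^sub>p\<close> and \<open>Y\<^sub>p\<close>, which is less than \<open>M\<close>. In the second case \<open>v\<close> is the gap preceded by
  \<open>w\<^sub>q\<close>.\<close>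

lemma y_extension:
  assumes v: "v \<in> AR_language d" and len: "length (w qy) + M \<le> length v"
  shows "sublist (Lc # w p @ [y]) v \<or> sublist (y # w p @ [Lc]) v \<or>
    (\<exists>l. l \<noteq> y \<and> v = w qy @ AR_word d my y @ AR_word d my l \<and> length v = length (w qy) + M)"
proof -
  have "length (w qy) < length v" using len block_lengths by simp
  from AR_window[OF v this, of my] obtain i P s Q where
    W: "v = take (length v) (drop i ((P @ s) @ Q))" "suffix (w my) (P @ s)" "prefix (AR_word d my y) Q"
    and sufP: "suffix (w my) P"
    and P: "length P \<le> i + length (w qy)" and lo: "i + length (w qy) < length (P @ s)"
    and s: "s = AR_word d my y \<or> (\<exists>l. l \<noteq> y \<and> s = AR_word d my y @ AR_word d my l)"
    using my(1) by (metis append.assoc)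
  have sM: "length s \<le> M"
    using s
  proof (elim disjE exE conjE)
    fix l assume l: "l \<noteq> y" "s = AR_word d my y @ AR_word d my l"
    then have "length s = length (AR_word d (Suc my) l)" using my by simp
    also have "\<dots> \<le> M" using letter_cases[of l] l unfolding M_def by auto
    finally show ?thesis .
  qed (use block_lengths(5) in simp)
  show ?thesis
  proof (cases "length (P @ s) < i + length v")
    case True
    show ?thesis
    proof (cases "i + length (w p) + 1 \<le> length (P @ s)")
      case True
      then have "sublist (Lc # w p @ [y]) v"
        using bispecial_left_extension[of p d my y "P @ s" Q i "length v"] p mx my xy W
          \<open>length (P @ s) < i + length v\<close> by simp
      then show ?thesis ..
    next
      case False
      then have "length (P @ s) + length (AR_word d p y) + 1 \<le> i + length v"
        using len block_lengths by simp
      then have "sublist (y # w p @ [Lc]) v"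
        using bispecial_right_extension[of p d my y qy "P @ s" Q i "length v"] p mx my xy qy W lo
        by simp
      then show ?thesis by blast
    qed
  next
    case False
    then have eq: "length P = i + length (w qy)" "length s = M" "length v = length (w qy) + M"
      using P sM len by auto
    have "suffix (w qy) (w my)"
      using qy mx my by (intro bispecial_suffix_mono) simp
    then obtain r where r: "P = r @ w qy"
      using sufP by (metis suffix_order.order_trans suffix_def)
    have "length r = i" using eq r by simp
    then have "v = w qy @ s"
      using W(1) eq r by simp
    moreover have "s \<noteq> AR_word d my y" using eq block_lengths by auto
    ultimately show ?thesis using s eq by blast
  qed
qed

lemma first_b: "w m = replicate m La" "AR_word d m Lb = Lb # w m"
proof -
  have "k \<le> m \<Longrightarrow> w k = replicate k La \<and> AR_word d k La = [La]" for k
  proof (induction k)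
    case (Suc k)
    then show ?case using m(4)[of k] by (simp add: replicate_append_same)
  qed simp
  then show "w m = replicate m La" by simp
  show "AR_word d m Lb = Lb # w m"
    using m(4) by (intro AR_word_before_first_rule) auto
qed

lemma bispecial_p_form:
  obtains r r' where "w p = w m @ Lb # w m @ r" "w p = r' @ w m @ Lb # w m"
proof -
  have "w (Suc m) = w m @ Lb # w m" using m first_b by simp
  then show thesis
    using that bispecial_prefix_mono[of "Suc m" p d] bispecial_suffix_mono[of "Suc m" p d] m(2)
    by (auto simp: prefix_def suffix_def)
qed

text \<open>The shorter extensions that \<open>no_order_condition\<close> requires need no separate search: \<open>w\<^sub>p\<close> begins
  and ends with \<open>w\<^sub>m b w\<^sub>m\<close>, so they are factors of the extensions of \<open>w\<^sub>p\<close>. One of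
  \<open>a w\<^sub>m b\<close> and \<open>b w\<^sub>m a\<close> is among them because \<open>a\<close> is \<open>x\<close> or \<open>y\<close>.\<close>

theorem clustering_imp_exceptional:
  assumes v: "v \<in> AR_language d" and len: "length (w qy) + M \<le> length v" and cl: "clustering v"
  shows "\<exists>l. l \<noteq> y \<and> v = w qy @ AR_word d my y @ AR_word d my l \<and> length v = length (w qy) + M"
proof (rule ccontr)
  assume "\<not> ?thesis"
  then have Y: "sublist (Lc # w p @ [y]) v \<or> sublist (y # w p @ [Lc]) v"
    using y_extension[OF v len] by blast
  note X = x_extensions[OF v len]
  obtain n where n: "m = Suc n" using m(1) by (cases m) auto
  obtain r r' where wp: "w p = w m @ Lb # w m @ r" "w p = r' @ w m @ Lb # w m"
    by (rule bispecial_p_form)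
  have wm: "w m = La # replicate n La" "w m = replicate n La @ [La]"
    using first_b n by (simp_all add: replicate_append_same)
  have c1: "sublist (Lc # w m @ [Lb]) (Lc # w p @ [l])" for l
    unfolding wp(1) by (intro prefix_imp_sublist) (simp add: prefix_def)
  have c2: "sublist (Lb # w m @ [Lc]) (l # w p @ [Lc])" for l
    unfolding wp(2) by (intro suffix_imp_sublist) (simp add: suffix_def)
  have a1: "sublist (La # w m @ [Lb]) (La # w p @ [l])" for l
    unfolding wp(1) by (intro prefix_imp_sublist) (simp add: prefix_def)
  have a2: "sublist (Lb # w m @ [La]) (l # w p @ [La])" for l
    unfolding wp(2) by (intro suffix_imp_sublist) (simp add: suffix_def)
  have s1: "sublist (Lc # w m @ [Lb]) v" and s2: "sublist (Lb # w m @ [Lc]) v"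
    using c1 c2 X by (meson sublist_order.order_trans)+
  have "x = La \<or> y = La" using xy by (metis letter.exhaust)
  then have s3: "sublist (La # w m @ [Lb]) v \<or> sublist (Lb # w m @ [La]) v"
    using a1 a2 X Y by (meson sublist_order.order_trans)
  have two: "sublist [Lc, La] v" "sublist [La, Lb] v" "sublist [Lb, La] v" "sublist [La, Lc] v"
  proof -
    have "sublist [Lc, La] (Lc # w m @ [Lb])"
      unfolding wm(1) by (intro prefix_imp_sublist) simp
    then show "sublist [Lc, La] v" using s1 by (rule sublist_order.order_trans)
    have "sublist [La, Lb] (Lc # w m @ [Lb])"
      unfolding wm(2) by (intro suffix_imp_sublist) (simp add: suffix_def)
    then show "sublist [La, Lb] v" using s1 by (rule sublist_order.order_trans)
    have "sublist [Lb, La] (Lb # w m @ [Lc])"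
      unfolding wm(1) by (intro prefix_imp_sublist) simp
    then show "sublist [Lb, La] v" using s2 by (rule sublist_order.order_trans)
    have "sublist [La, Lc] (Lb # w m @ [Lc])"
      unfolding wm(2) by (intro suffix_imp_sublist) (simp add: suffix_def)
    then show "sublist [La, Lc] v" using s2 by (rule sublist_order.order_trans)
  qed
  obtain f g where fg: "inj f" "inj g" "order_condition f g v"
    using cl by (rule clustering_imp_order_condition)
  show False
    using no_order_condition[OF fg(3,1,2) xy, of "w m" "w p"] two s1 s2 s3 X Y
    by (auto simp: sublist_imp_cyclic_factor)
qed

end



section \<open>Clustering words of length at least the bound minus one\<close>

lemma mu_properties:
  assumes "AR_directive d"
  shows "lambda2 d < mu d l" "d (mu d l) = l" "lambda2 d < j \<Longrightarrow> j < mu d l \<Longrightarrow> d j \<noteq> l"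
proof -
  have "\<exists>k>lambda2 d. d k = l"
    using assms unfolding AR_directive_def infinite_nat_iff_unbounded by blast
  then show "lambda2 d < mu d l" "d (mu d l) = l"
    unfolding mu_def by (metis (mono_tags, lifting) LeastI_ex)+
  show "lambda2 d < j \<Longrightarrow> j < mu d l \<Longrightarrow> d j \<noteq> l"
    unfolding mu_def using not_less_Least by blast
qed

lemma lambda2_properties:
  assumes "AR_directive d"
  shows "d (lambda2 d) = Lc" "j < lambda2 d \<Longrightarrow> d j \<noteq> Lc"
proof -
  have "\<exists>k. d k = Lc"
    using assms unfolding AR_directive_def infinite_nat_iff_unbounded by blast
  then show "d (lambda2 d) = Lc" unfolding lambda2_def by (rule LeastI_ex)
  show "j < lambda2 d \<Longrightarrow> d j \<noteq> Lc"
    unfolding lambda2_def using not_less_Least by blast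
qed

lemma lam_properties:
  assumes "k < lambda2 d" "d k = l"
  shows "lam d l < lambda2 d" "d (lam d l) = l" "lam d l < j \<Longrightarrow> j < lambda2 d \<Longrightarrow> d j \<noteq> l"
proof -
  let ?P = "\<lambda>k. k < lambda2 d \<and> d k = l"
  have "?P (lam d l)"
    unfolding lam_def by (rule GreatestI_nat[of ?P k "lambda2 d"]) (use assms in auto)
  then show "lam d l < lambda2 d" "d (lam d l) = l" by auto
  show "d j \<noteq> l" if "lam d l < j" "j < lambda2 d"
    using Greatest_le_nat[of ?P j "lambda2 d"] that unfolding lam_def by fastforce
qed

lemma AR_stages_of_directive:
  assumes d: "AR_directive d" "Rabc d"
  shows "AR_stages d (letter_x d) (letter_y d) (LEAST k. d k \<noteq> La) (lambda2 d)
           (lam d (letter_x d)) (lam d (letter_y d)) (mu d (letter_x d)) (mu d (letter_y d))"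
proof -
  define m where "m = (LEAST k. d k \<noteq> La)"
  have m: "d m = Lb" "d 0 = La" using d(2) by (simp_all add: Rabc_def m_def)
  have before_m: "j < m \<Longrightarrow> d j = La" for j
    unfolding m_def using not_less_Least by blast
  have "0 < m" using m by (cases m) auto
  have "m < lambda2 d"
    using m before_m lambda2_properties(1)[OF d(1)] by (metis letter.distinct(4,6) linorder_neqE_nat)
  have xy: "letter_x d = La \<and> letter_y d = Lb \<or> letter_x d = Lb \<and> letter_y d = La"
    by (auto simp: letter_x_def letter_y_def)
  have "mu d La \<noteq> mu d Lb" using mu_properties(2)[OF d(1)] by (metis letter.distinct(1))
  then have mu_less: "mu d (letter_x d) < mu d (letter_y d)"
    by (auto simp: letter_x_def letter_y_def)
  have lam: "lam d l < lambda2 d" "d (lam d l) = l"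
      "\<And>j. lam d l < j \<Longrightarrow> j < lambda2 d \<Longrightarrow> d j \<noteq> l" if "l = La \<or> l = Lb" for l
    using lam_properties[of 0 d l] lam_properties[of m d l] that m \<open>0 < m\<close> \<open>m < lambda2 d\<close> by auto
  show ?thesis
    unfolding m_def[symmetric]
  proof
    show "letter_x d \<noteq> letter_y d" "letter_x d \<noteq> Lc" "letter_y d \<noteq> Lc" using xy by auto
    show "0 < m" "m < lambda2 d" "d m = Lb" "\<And>j. j < m \<Longrightarrow> d j = La" by fact+
    show "d j = Lc \<longleftrightarrow> j = lambda2 d" if "j \<le> lambda2 d" for j
      using that lambda2_properties[OF d(1)] by (auto simp: le_less)
    show "d (lam d (letter_x d)) = letter_x d" "lam d (letter_x d) < lambda2 d"
      "\<And>j. lam d (letter_x d) < j \<Longrightarrow> j < lambda2 d \<Longrightarrow> d j \<noteq> letter_x d"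
      "d (lam d (letter_y d)) = letter_y d" "lam d (letter_y d) < lambda2 d"
      "\<And>j. lam d (letter_y d) < j \<Longrightarrow> j < lambda2 d \<Longrightarrow> d j \<noteq> letter_y d"
      using lam xy by auto
    show "d (mu d (letter_x d)) = letter_x d" "lambda2 d < mu d (letter_x d)"
      "d (mu d (letter_y d)) = letter_y d" "mu d (letter_x d) < mu d (letter_y d)"
      using mu_properties[OF d(1)] mu_less by auto
    \<comment> \<open>Before \<open>\<mu>\<^sub>x\<close> neither \<open>x\<close> nor \<open>y\<close> is used, because \<open>\<mu>\<^sub>x < \<mu>\<^sub>y\<close>.\<close>
    show "d j = Lc" if "lambda2 d \<le> j" "j < mu d (letter_x d)" for j
    proof (cases "j = lambda2 d")
      case False
      then have "d j \<noteq> letter_x d" "d j \<noteq> letter_y d"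
        using that mu_less mu_properties(3)[OF d(1)] by auto
      then show ?thesis using xy by (metis letter.exhaust)
    qed (use lambda2_properties[OF d(1)] in simp)
  qed
qed

corollary clustering_length_bound_minus_1:
  assumes d: "AR_directive d" "Rabc d"
    and v: "v \<in> AR_language d" "bound d \<le> length v + 1" "clustering v"
  shows "length v + 1 = bound d"
    and "\<exists>l. l \<noteq> letter_y d \<and> v = bispecial d (lam d (letter_y d))
           @ AR_word d (mu d (letter_y d)) (letter_y d) @ AR_word d (mu d (letter_y d)) l"
proof -
  interpret AR_stages d "letter_x d" "letter_y d" "LEAST k. d k \<noteq> La" "lambda2 d"
    "lam d (letter_x d)" "lam d (letter_y d)" "mu d (letter_x d)" "mu d (letter_y d)"
    using d by (rule AR_stages_of_directive)
  have "bound d = length (w (lam d (letter_y d))) + M + 1"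
    by (simp add: bound_def M_def)
  then show "length v + 1 = bound d"
    and "\<exists>l. l \<noteq> letter_y d \<and> v = bispecial d (lam d (letter_y d))
           @ AR_word d (mu d (letter_y d)) (letter_y d) @ AR_word d (mu d (letter_y d)) l"
    using clustering_imp_exceptional[OF v(1)] v by auto
qed


section \<open>Three directive words\<close>

lemma lambda2_eqI: "d p = Lc \<Longrightarrow> \<forall>j\<in>{..<p}. d j \<noteq> Lc \<Longrightarrow> lambda2 d = p"
  unfolding lambda2_def by (rule Least_equality) (auto simp: not_less[symmetric])

lemma lam_eqI:
  "lambda2 d = p \<Longrightarrow> q < p \<Longrightarrow> d q = l \<Longrightarrow> \<forall>j\<in>{q<..<p}. d j \<noteq> l \<Longrightarrow> lam d l = q"
  unfolding lam_def by (rule Greatest_equality) (auto simp: not_less[symmetric])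

lemma mu_eqI:
  "lambda2 d = p \<Longrightarrow> p < k \<Longrightarrow> d k = l \<Longrightarrow> \<forall>j\<in>{p<..<k}. d j \<noteq> l \<Longrightarrow> mu d l = k"
  unfolding mu_def by (rule Least_equality) (auto simp: not_less[symmetric])

lemma AR_directive_periodicI:
  assumes "0 < q" and "\<And>l. \<exists>r. \<forall>n. d (r + q * n) = l"
  shows "AR_directive d"
  unfolding AR_directive_def
proof
  fix l
  obtain r where r: "\<And>n. d (r + q * n) = l" using assms(2) by blast
  have "inj (\<lambda>n. r + q * n)" using assms(1) by (auto simp: inj_def)
  then have "infinite (range (\<lambda>n. r + q * n))" by (rule range_inj_infinite)
  then show "infinite {k. d k = l}"
    by (rule infinite_super[rotated]) (use r in auto)
qed

definition abcb_directive :: "nat \<Rightarrow> letter" where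
  "abcb_directive k = [La, Lb, Lc, Lb] ! (k mod 4)"

definition la_tribonacci :: "nat \<Rightarrow> letter" where
  "la_tribonacci k = (case k of 0 \<Rightarrow> La | Suc j \<Rightarrow> tribonacci j)"

lemma tribonacci_parameters:
  "lambda2 tribonacci = 2" "lam tribonacci La = 0" "lam tribonacci Lb = 1"
  "mu tribonacci La = 3" "mu tribonacci Lb = 4"
proof -
  show 2: "lambda2 tribonacci = 2" by (rule lambda2_eqI; code_simp)
  show "lam tribonacci La = 0" "lam tribonacci Lb = 1" by (rule lam_eqI[OF 2]; code_simp)+
  show "mu tribonacci La = 3" "mu tribonacci Lb = 4" by (rule mu_eqI[OF 2]; code_simp)+
qed

lemma la_tribonacci_parameters:
  "lambda2 la_tribonacci = 3" "lam la_tribonacci La = 1" "lam la_tribonacci Lb = 2"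
  "mu la_tribonacci La = 4" "mu la_tribonacci Lb = 5"
proof -
  show 3: "lambda2 la_tribonacci = 3" by (rule lambda2_eqI; code_simp)
  show "lam la_tribonacci La = 1" "lam la_tribonacci Lb = 2" by (rule lam_eqI[OF 3]; code_simp)+
  show "mu la_tribonacci La = 4" "mu la_tribonacci Lb = 5" by (rule mu_eqI[OF 3]; code_simp)+
qed

lemma abcb_parameters:
  "lambda2 abcb_directive = 2" "lam abcb_directive La = 0" "lam abcb_directive Lb = 1"
  "mu abcb_directive La = 4" "mu abcb_directive Lb = 3"
proof -
  show 2: "lambda2 abcb_directive = 2" by (rule lambda2_eqI; code_simp)
  show "lam abcb_directive La = 0" "lam abcb_directive Lb = 1" by (rule lam_eqI[OF 2]; code_simp)+
  show "mu abcb_directive La = 4" "mu abcb_directive Lb = 3" by (rule mu_eqI[OF 2]; code_simp)+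
qed

lemma AR_directive_la_tribonacci: "AR_directive la_tribonacci"
proof (rule AR_directive_periodicI[of 3])
  fix l
  obtain r where r: "tribonacci r = l"
  proof
    show "tribonacci (case l of La \<Rightarrow> 0 | Lb \<Rightarrow> 1 | Lc \<Rightarrow> 2) = l"
      by (cases l) (simp_all add: tribonacci_def)
  qed
  have "la_tribonacci (Suc r + 3 * n) = l" for n
    using r by (simp add: la_tribonacci_def tribonacci_def)
  then show "\<exists>r. \<forall>n. la_tribonacci (r + 3 * n) = l" by blast
qed simp

lemma AR_directive_abcb: "AR_directive abcb_directive"
proof (rule AR_directive_periodicI[of 4])
  fix l
  obtain r where r: "abcb_directive r = l"
  proof
    show "abcb_directive (case l of La \<Rightarrow> 0 | Lb \<Rightarrow> 1 | Lc \<Rightarrow> 2) = l"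
      by (cases l) (simp_all add: abcb_directive_def)
  qed
  have "abcb_directive (r + 4 * n) = l" for n
    using r by (simp add: abcb_directive_def)
  then show "\<exists>r. \<forall>n. abcb_directive (r + 4 * n) = l" by blast
qed simp

lemma RabcI: "0 < m \<Longrightarrow> d m = Lb \<Longrightarrow> \<forall>j<m. d j = La \<Longrightarrow> Rabc d"
proof -
  assume m: "0 < m" "d m = Lb" "\<forall>j<m. d j = La"
  then have "(LEAST k. d k \<noteq> La) = m"
    by (intro Least_equality) (auto simp: not_less[symmetric])
  with m show "Rabc d" by (simp add: Rabc_def)
qed

definition swap_La_Lb :: "letter \<Rightarrow> letter" where
  "swap_La_Lb l = (case l of La \<Rightarrow> Lb | Lb \<Rightarrow> La | Lc \<Rightarrow> Lc)"

lemma bij_swap_La_Lb: "bij swap_La_Lb"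
  by (rule involuntory_imp_bij) (simp add: swap_La_Lb_def split: letter.split)

lemma swap_La_Lb_neq_id: "swap_La_Lb \<noteq> id"
proof
  assume "swap_La_Lb = id"
  then have "swap_La_Lb La = La" by simp
  then show False by (simp add: swap_La_Lb_def)
qed

lemma bound_tribonacci: "bound tribonacci = 26"
proof -
  have "letter_x tribonacci = La" "letter_y tribonacci = Lb"
    by (simp_all add: letter_x_def letter_y_def tribonacci_parameters)
  then have "bound tribonacci = length (bispecial tribonacci 1)
     + max (length (AR_word tribonacci (4 + 1) Lc)) (length (AR_word tribonacci (4 + 1) La)) + 1"
    by (simp only: bound_def tribonacci_parameters)
  also have "\<dots> = 26" by code_simp
  finally show ?thesis .
qed

text \<open>The exceptional word \<open>w\<^sub>q Y Z\<close> for the Tribonacci language, with \<open>q = 1\<close>, \<open>\<mu>\<^sub>y = 4\<close> and \<open>Z = C\<close>.\<close>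

definition tribonacci_clustering_word :: "letter list" where
  "tribonacci_clustering_word =
     bispecial tribonacci 1 @ AR_word tribonacci 4 Lb @ AR_word tribonacci 4 Lc"

text \<open>With the order \<open>a < c < b\<close> the transform of this word is \<open>b\<^sup>7 c\<^sup>4 a\<^sup>1\<^sup>4\<close>.\<close>

lemma tribonacci_clustering_word:
  "tribonacci_clustering_word \<in> AR_language tribonacci"
  "length tribonacci_clustering_word = 25"
  "clustering tribonacci_clustering_word"
proof -
  have "sublist tribonacci_clustering_word (AR_word tribonacci 7 Lc)" by code_simp
  then show "tribonacci_clustering_word \<in> AR_language tribonacci"
    unfolding AR_language_def by blast
  show "length tribonacci_clustering_word = 25" by code_simp
  have "alphabet_order [La, Lc, Lb]"
    unfolding alphabet_order_def using letter.nchotomy by auto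
  moreover have "clusters_for [La, Lc, Lb] swap_La_Lb tribonacci_clustering_word"
    by code_simp
  ultimately show "clustering tribonacci_clustering_word"
    unfolding clustering_def using bij_swap_La_Lb swap_La_Lb_neq_id by blast
qed

text \<open>The pair of words around \<open>u\<close> requires \<open>f\<close> to order \<open>x, x'\<close> as \<open>g\<close> orders \<open>y, y'\<close>, and the pair
  around \<open>s\<close> requires the opposite.\<close>

lemma crossed_extensions:
  assumes oc: "order_condition f g v" "inj g"
    and ne: "x \<noteq> x'" "y \<noteq> y'"
    and u: "cyclic_factor x u y v" "cyclic_factor x' u y' v"
    and s: "cyclic_factor x s y' v" "cyclic_factor x' s y v"
  shows False
proof -
  have "g y \<noteq> g y'" using oc ne by (simp add: inj_eq)
  then consider "g y < g y'" | "g y' < g y" by linarith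
  then show False
  proof cases
    case 1
    then have "f x < f x'" "f x' < f x"
      using oc(1) ne u s unfolding order_condition_def by metis+
    then show False by simp
  next
    case 2
    then have "f x < f x'" "f x' < f x"
      using oc(1) ne u s unfolding order_condition_def by metis+
    then show False by simp
  qed
qed

text \<open>The exceptional word ends with \<open>aa\<close> and begins with \<open>aabaacaabaaa\<close>. So, for
  \<open>u = aaabaacaabaa\<close>, the circular word has \<open>a u a\<close> across its ends. Together with the factor \<open>b u c\<close>
  this is crossed by the extensions \<open>ac\<close> and \<open>ba\<close> of the empty word.\<close>

lemma la_tribonacci_example:
  shows "letter_x la_tribonacci = La" "letter_y la_tribonacci = Lb" "Rabc la_tribonacci"
    and "bound la_tribonacci = 38"
    and "v \<in> AR_language la_tribonacci \<Longrightarrow> length v = 37 \<Longrightarrow> \<not> clustering v"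
proof -
  show x: "letter_x la_tribonacci = La" and y: "letter_y la_tribonacci = Lb"
    by (simp_all add: letter_x_def letter_y_def la_tribonacci_parameters)
  show Rabc: "Rabc la_tribonacci"
    by (rule RabcI[of 2]; code_simp)
  have "bound la_tribonacci = length (bispecial la_tribonacci 2)
     + max (length (AR_word la_tribonacci (5 + 1) Lc)) (length (AR_word la_tribonacci (5 + 1) La)) + 1"
    by (simp only: bound_def la_tribonacci_parameters x y)
  also have "\<dots> = 38" by code_simp
  finally show bound: "bound la_tribonacci = 38" .
  assume v: "v \<in> AR_language la_tribonacci" "length v = 37"
  show "\<not> clustering v"
  proof
    assume cl: "clustering v"
    obtain l where l: "l \<noteq> Lb"
      and v': "v = bispecial la_tribonacci 2 @ AR_word la_tribonacci 5 Lb @ AR_word la_tribonacci 5 l"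
      using clustering_length_bound_minus_1(2)[OF AR_directive_la_tribonacci Rabc v(1) _ cl] v(2)
      unfolding bound y la_tribonacci_parameters by auto
    have "length (bispecial la_tribonacci 2 @ AR_word la_tribonacci 5 Lb @ AR_word la_tribonacci 5 La) \<noteq> 37"
      by code_simp
    then have "l \<noteq> La" using v(2) v' by metis
    then have "l = Lc" using l by (metis letter.exhaust)
    moreover have "bispecial la_tribonacci 2 @ AR_word la_tribonacci 5 Lb @ AR_word la_tribonacci 5 Lc
      = [La,La,Lb,La,La,Lc,La,La,Lb,La,La,La,Lb,La,La,Lc,La,La,Lb,La,La,Lc,La,La,Lb,La,La,La,Lb,La,La,Lc,La,La,Lb,La,La]"
      by code_simp
    ultimately have word: "v = [La,La,Lb,La,La,Lc,La,La,Lb,La,La,La,Lb,La,La,Lc,La,La,Lb,La,La,Lc,La,La,Lb,La,La,La,Lb,La,La,Lc,La,La,Lb,La,La]"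
      using v' by metis
    let ?s = "[La,La,Lb,La,La,Lc,La,La,Lb,La,La]"
    have "sublist (La # [] @ [Lc]) v" "sublist (Lb # [] @ [La]) v"
      "sublist (Lb # (La # ?s) @ [Lc]) v"
      unfolding word by code_simp+
    then have "cyclic_factor La [] Lc v" "cyclic_factor Lb [] La v"
      "cyclic_factor Lb (La # ?s) Lc v"
      by (blast intro: sublist_imp_cyclic_factor)+
    moreover have "cyclic_factor La ([La] @ ?s) La v"
      using cyclic_factor_wrapI[of La "[La]" ?s La
        "[Lb,La,La,Lc,La,La,Lb,La,La,Lc,La,La,Lb,La,La,La,Lb,La,La,Lc,La,La,Lb]"]
      unfolding word by simp
    moreover obtain f g where "inj g" "order_condition f g v"
      using cl by (rule clustering_imp_order_condition)
    ultimately show False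
      using crossed_extensions[of f g v La Lb La Lc "La # ?s" "[]"] by simp
  qed
qed

text \<open>Here \<open>w\<^sub>p = aba\<close>, and the exceptional word begins with \<open>abac\<close> and ends with \<open>ba\<close>. Across its ends
  the circular word has \<open>aabac\<close>, which is \<open>y w\<^sub>p c\<close>, and \<open>baa\<close>.\<close>

lemma abcb_example:
  shows "letter_x abcb_directive = Lb" "letter_y abcb_directive = La" "Rabc abcb_directive"
    and "bound abcb_directive = 24"
    and "v \<in> AR_language abcb_directive \<Longrightarrow> length v = 23 \<Longrightarrow> \<not> clustering v"
proof -
  show x: "letter_x abcb_directive = Lb" and y: "letter_y abcb_directive = La"
    by (simp_all add: letter_x_def letter_y_def abcb_parameters)
  show Rabc: "Rabc abcb_directive"
    by (rule RabcI[of 1]; code_simp)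
  have "bound abcb_directive = length (bispecial abcb_directive 0)
     + max (length (AR_word abcb_directive (4 + 1) Lc)) (length (AR_word abcb_directive (4 + 1) Lb)) + 1"
    by (simp only: bound_def abcb_parameters x y)
  also have "\<dots> = 24" by code_simp
  finally show bound: "bound abcb_directive = 24" .
  assume v: "v \<in> AR_language abcb_directive" "length v = 23"
  show "\<not> clustering v"
  proof
    assume cl: "clustering v"
    obtain l where l: "l \<noteq> La"
      and v': "v = bispecial abcb_directive 0 @ AR_word abcb_directive 4 La @ AR_word abcb_directive 4 l"
      using clustering_length_bound_minus_1(2)[OF AR_directive_abcb Rabc v(1) _ cl] v(2)
      unfolding bound y abcb_parameters by auto
    have "length (bispecial abcb_directive 0 @ AR_word abcb_directive 4 La @ AR_word abcb_directive 4 Lb) \<noteq> 23"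
      by code_simp
    then have "l \<noteq> Lb" using v(2) v' by metis
    then have "l = Lc" using l by (metis letter.exhaust)
    moreover have "bispecial abcb_directive 0 @ AR_word abcb_directive 4 La @ AR_word abcb_directive 4 Lc
      = [La,Lb,La,Lc,La,Lb,La,Lb,La,Lc,La,Lb,La,Lc,La,Lb,La,Lb,La,Lc,La,Lb,La]"
      by code_simp
    ultimately have word: "v = [La,Lb,La,Lc,La,Lb,La,Lb,La,Lc,La,Lb,La,Lc,La,Lb,La,Lb,La,Lc,La,Lb,La]"
      using v' by metis
    have "sublist (Lb # [] @ [La]) v" "sublist (La # [] @ [Lb]) v"
      "sublist (La # [] @ [Lc]) v" "sublist (Lc # [] @ [La]) v"
      "sublist (Lc # [La] @ [Lb]) v" "sublist (Lb # [La] @ [Lc]) v"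
      "sublist (Lc # [La,Lb,La] @ [Lb]) v" "sublist (Lb # [La,Lb,La] @ [Lc]) v"
      unfolding word by code_simp+
    then have "cyclic_factor Lb [] La v" "cyclic_factor La [] Lb v"
      "cyclic_factor La [] Lc v" "cyclic_factor Lc [] La v"
      "cyclic_factor Lc [La] Lb v" "cyclic_factor Lb [La] Lc v"
      "cyclic_factor Lc [La,Lb,La] Lb v" "cyclic_factor Lb [La,Lb,La] Lc v"
      by (blast intro: sublist_imp_cyclic_factor)+
    moreover have "cyclic_factor La ([] @ [La,Lb,La]) Lc v"
      using cyclic_factor_wrapI[of La "[]" "[La,Lb,La]" Lc
        "[La,Lb,La,Lb,La,Lc,La,Lb,La,Lc,La,Lb,La,Lb,La,Lc,La,Lb]"]
      unfolding word by simp
    moreover obtain f g where "inj f" "inj g" "order_condition f g v"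
      using cl by (rule clustering_imp_order_condition)
    moreover have "cyclic_factor Lb ([La] @ []) La v"
      using cyclic_factor_wrapI[of Lb "[La]" "[]" La
        "[Lb,La,Lc,La,Lb,La,Lb,La,Lc,La,Lb,La,Lc,La,Lb,La,Lb,La,Lc,La]"]
      unfolding word by simp
    ultimately show False
      using no_order_condition[of f g v Lb La "[La]" "[La,Lb,La]"] by simp
  qed
qed

section \<open>The bound and its sharpness\<close>

theorem theorem10:
  shows
    "(\<forall>d. AR_directive d \<and> Rabc d \<longrightarrow>
        (\<forall>v \<in> AR_language d. length v \<ge> bound d \<longrightarrow> \<not> clustering v))
     \<and> (\<exists>v \<in> AR_language tribonacci. length v = bound tribonacci - 1 \<and> clustering v)
     \<and> (\<exists>d. AR_directive d \<and> Rabc d \<and> lam d (letter_x d) < lam d (letter_y d) \<and>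
          (\<forall>v \<in> AR_language d. length v = bound d - 1 \<longrightarrow> \<not> clustering v))
     \<and> (\<exists>d. AR_directive d \<and> Rabc d \<and> lam d (letter_y d) < lam d (letter_x d) \<and>
          (\<forall>v \<in> AR_language d. length v = bound d - 1 \<longrightarrow> \<not> clustering v))"
proof (intro conjI allI impI ballI)
  fix d v
  assume d: "AR_directive d \<and> Rabc d" and v: "v \<in> AR_language d" "bound d \<le> length v"
  show "\<not> clustering v"
  proof
    assume "clustering v"
    then have "length v + 1 = bound d"
      using clustering_length_bound_minus_1(1) d v by (meson trans_le_add1)
    with v(2) show False by simp
  qed
next
  show "\<exists>v \<in> AR_language tribonacci. length v = bound tribonacci - 1 \<and> clustering v"
    using tribonacci_clustering_word by (auto simp: bound_tribonacci)
next
  show "\<exists>d. AR_directive d \<and> Rabc d \<and> lam d (letter_x d) < lam d (letter_y d) \<and>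
          (\<forall>v \<in> AR_language d. length v = bound d - 1 \<longrightarrow> \<not> clustering v)"
    using la_tribonacci_example AR_directive_la_tribonacci
    by (intro exI[of _ la_tribonacci]) (simp add: la_tribonacci_parameters)
next
  show "\<exists>d. AR_directive d \<and> Rabc d \<and> lam d (letter_y d) < lam d (letter_x d) \<and>
          (\<forall>v \<in> AR_language d. length v = bound d - 1 \<longrightarrow> \<not> clustering v)"
    using abcb_example AR_directive_abcb
    by (intro exI[of _ abcb_directive]) (simp add: abcb_parameters)
qed

end
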